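(* Let $G$ be a finitely generated group acting transitively (on the right) on a space $X$. Fix a finite generating set $S$ of $G$ and let $\Gamma=(X,E)$ be the associated Schreier graph. Let $\mu$ be a probability measure on $G$ with a finite first moment such that the induced random walk on $\Gamma$ is transient. Then the induced random walk almost surely converges towards a (random) end of the graph $\Gamma$.
   Context: Schreier graph: $\Gamma=(X,E)$ is the undirected graph with vertex set $X$ and edges $E=\{(x,x.s) : x\in X,\ s\in S\}$; it is connected since the action is transitive. First moment: the first moment of $\mu$ is $\sum_{g\in G}|g|\,\mu(g)$, where $|g|$ is the word length of $g$ with respect to a finite generating set. Induced random walk: let $(h_n)$ be i.i.d. with law $\mu$, let $g_0=e$ and $g_{n+1}=g_nh_n$. For a fixed starting point $\mathfrak{o}\in X$, the induced random walk on $X$ (or on $\Gamma$) starting at $\mathfrak{o}$ is $(\mathfrak{o}.g_n)_{n}$; it is the Markov chain with kernel $P(x,y)=\sum_{g\in G:\, x.g=y}\mu(g)$. Transience: the walk is transient if, for any point, almost every trajectory leaves that point after finite time, i.e. visits it only finitely often; equivalently, $\sum_{n}p^{(n)}(x,x)<\infty$ for all $x\in X$, where $p^{(n)}$ denotes the $n$-step transition probability. Ends: for a finite set $K\subset X$ let $\pi_0(X\setminus K)$ be the set of connected components of the subgraph obtained by deleting the vertices of $K$ and the edges adjacent to them. For $K_1\subseteq K_2$ there is a natural map $\pi_0(X\setminus K_2)\to\pi_0(X\setminus K_1)$ sending a component to the component containing it. The end space is the inverse limit $\varprojlim_K \pi_0(X\setminus K)$ over finite $K\subset X$. Equivalently,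 for an increasing exhaustive sequence $K_1\subset K_2\subset\dots$ of finite subsets of $X$, an end is a sequence $U_1\supseteq U_2\supseteq\dots$ where $U_n$ is an infinite connected component of the complement of $K_n$. A trajectory $(x_n)$ converges towards an end $(U_K)_K$ if for every finite $K\subset X$ one has $x_n\in U_K$ for all sufficiently large $n$. *)

theory Defs
  imports "HOL-Algebra.Generated_Groups" "HOL-Probability.Probability"
begin

text \<open>The action of HOL-Algebra's \<open>group_action\<close> is a left action; here \<open>act x g\<close> stands for
  the right action \<open>x.g\<close>.\<close>

locale right_group_action = group G for G (structure) +
  fixes X :: "'x set" and act :: "'x \<Rightarrow> 'g \<Rightarrow> 'x"
  assumes act_closed: "\<lbrakk>x \<in> X; g \<in> carrier G\<rbrakk> \<Longrightarrow> act x g \<in> X"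
    and act_one: "x \<in> X \<Longrightarrow> act x \<one> = x"
    and act_mult: "\<lbrakk>x \<in> X; g \<in> carrier G; h \<in> carrier G\<rbrakk> \<Longrightarrow> act x (g \<otimes> h) = act (act x g) h"

locale transitive_right_action = right_group_action +
  assumes transitive: "\<lbrakk>x \<in> X; y \<in> X\<rbrakk> \<Longrightarrow> \<exists>g \<in> carrier G. act x g = y"

definition word_length :: "('g, 'b) monoid_scheme \<Rightarrow> 'g set \<Rightarrow> 'g \<Rightarrow> nat" where
  "word_length G S g =
     (LEAST n. \<exists>ws. set ws \<subseteq> S \<union> (\<lambda>s. inv\<^bsub>G\<^esub> s) ` S \<and> length ws = n \<and> foldr (\<otimes>\<^bsub>G\<^esub>) ws \<one>\<^bsub>G\<^esub> = g)"

definition finite_first_moment :: "('g, 'b) monoid_scheme \<Rightarrow> 'g set \<Rightarrow> 'g pmf \<Rightarrow> bool" where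
  "finite_first_moment G S \<mu> \<longleftrightarrow>
     (\<lambda>g. real (word_length G S g) * pmf \<mu> g) summable_on carrier G"

text \<open>The Schreier graph is undirected and \<open>S\<close> need not be symmetric, so the edge relation is
  closed under converse. Loops are kept; they do not affect connected components.\<close>

definition schreier_edges :: "'x set \<Rightarrow> ('x \<Rightarrow> 'g \<Rightarrow> 'x) \<Rightarrow> 'g set \<Rightarrow> ('x \<times> 'x) set" where
  "schreier_edges X act S =
     {(x, act x s) | x s. x \<in> X \<and> s \<in> S} \<union> {(act x s, x) | x s. x \<in> X \<and> s \<in> S}"

text \<open>Connected components of the graph \<open>(X, E)\<close> after deletion of the vertices in \<open>K\<close> and the
  edges touching them, for a symmetric edge relation \<open>E\<close>.\<close>

definition components_off :: "'x set \<Rightarrow> ('x \<times> 'x) set \<Rightarrow> 'x set \<Rightarrow> 'x set set" where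
  "components_off X E K = (X - K) // (E \<inter> (X - K) \<times> (X - K))\<^sup>*"

text \<open>The inverse limit of \<open>components_off X E K\<close> over the finite subsets \<open>K\<close> of \<open>X\<close>. For
  \<open>K1 \<subseteq> K2\<close> the bonding map sends a component to the component containing it, so \<open>U K2\<close> is
  mapped to \<open>U K1\<close> exactly when \<open>U K2 \<subseteq> U K1\<close>. (Each \<open>U K\<close> is then infinite, since
  \<open>U (K \<union> L)\<close> is nonempty and contained in \<open>U K - L\<close> for every finite \<open>L\<close>.)\<close>

definition ends :: "'x set \<Rightarrow> ('x \<times> 'x) set \<Rightarrow> ('x set \<Rightarrow> 'x set) set" where
  "ends X E =
     {U \<in> (\<Pi>\<^sub>E K \<in> {K. finite K \<and> K \<subseteq> X}. components_off X E K).
        \<forall>K1 K2. finite K2 \<and> K2 \<subseteq> X \<and> K1 \<subseteq> K2 \<longrightarrow> U K2 \<subseteq> U K1}"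

definition converges_to_end :: "'x set \<Rightarrow> (nat \<Rightarrow> 'x) \<Rightarrow> ('x set \<Rightarrow> 'x set) \<Rightarrow> bool" where
  "converges_to_end X x U \<longleftrightarrow>
     (\<forall>K. finite K \<and> K \<subseteq> X \<longrightarrow> (\<forall>\<^sub>F n in sequentially. x n \<in> U K))"

primrec group_walk :: "('g, 'b) monoid_scheme \<Rightarrow> (nat \<Rightarrow> 'w \<Rightarrow> 'g) \<Rightarrow> nat \<Rightarrow> 'w \<Rightarrow> 'g" where
  "group_walk G h 0 \<omega> = \<one>\<^bsub>G\<^esub>"
| "group_walk G h (Suc n) \<omega> = group_walk G h n \<omega> \<otimes>\<^bsub>G\<^esub> h n \<omega>"

definition induced_walk ::
  "('g, 'b) monoid_scheme \<Rightarrow> ('x \<Rightarrow> 'g \<Rightarrow> 'x) \<Rightarrow> 'x \<Rightarrow> (nat \<Rightarrow> 'w \<Rightarrow> 'g) \<Rightarrow> nat \<Rightarrow> 'w \<Rightarrow> 'x" where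
  "induced_walk G act x h n \<omega> = act x (group_walk G h n \<omega>)"

definition iid_with_law :: "'w measure \<Rightarrow> (nat \<Rightarrow> 'w \<Rightarrow> 'g) \<Rightarrow> 'g pmf \<Rightarrow> bool" where
  "iid_with_law M h \<mu> \<longleftrightarrow>
     prob_space.indep_vars M (\<lambda>_. count_space UNIV) h UNIV \<and>
     (\<forall>n. distr M (count_space UNIV) (h n) = measure_pmf \<mu>)"

definition transient_walk :: "'w measure \<Rightarrow> 'x set \<Rightarrow> (nat \<Rightarrow> 'w \<Rightarrow> 'x) \<Rightarrow> bool" where
  "transient_walk M X x \<longleftrightarrow> (\<forall>y \<in> X. AE \<omega> in M. finite {n. x n \<omega> = y})"

end

theory Submission imports Defs begin

text \<open>For every \<open>g\<close> fix a shortest word representing it. Reading the word of the increment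
  \<open>h n\<close> from the point \<open>x n\<close> gives a path in the Schreier graph from \<open>x n\<close> to \<open>x (n + 1)\<close>, of
  length \<open>word_length (h n)\<close>; call its vertex set the \<open>n\<close>-th segment. If every vertex lies on
  only finitely many segments, then for every finite \<open>K\<close> the late segments avoid \<open>K\<close>, so the
  trajectory eventually stays in one component of the complement of \<open>K\<close>, and these components
  form an end (\<open>ex_end_if_segments_escape\<close>).

  By the Borel-Cantelli lemma it suffices that for each vertex \<open>v\<close> the probabilities that the
  \<open>n\<close>-th segment passes through \<open>v\<close> have a finite sum. If \<open>c g i\<close> is the product of the first \<open>i\<close>
  letters of the word of \<open>g\<close>, passing through \<open>v\<close> means \<open>x n = v.(c g i)\<inverse>\<close> for some \<open>i\<close>,
  with \<open>g = h n\<close> independent of \<open>x n\<close>. The sum is therefore at most the \<open>\<mu>\<close>-average over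
  \<open>g\<close> of the sum over \<open>i \<le> word_length g\<close> of the Green function
  \<open>\<Sum>n. P(x n = y)\<close> at \<open>y = v.(c g i)\<inverse>\<close> (\<open>AE_finite_passages_through\<close>). With a Green
  function bounded in \<open>y\<close>, the first moment condition makes this finite.

  The bound is a maximum principle: since every \<open>g\<close> permutes \<open>X\<close>, the counting measure is
  stationary, so the Green function of the walk started at \<open>x0\<close> is, away from \<open>x0\<close>, an average
  of its own values and is maximal at \<open>x0\<close> (\<open>sum_hit_le_sum_hit_start\<close>). Its value
  there is finite by transience: the walk makes almost surely exactly one last visit to
  \<open>x0\<close>, and the probability that this happens at time \<open>n\<close> is \<open>P(x n = x0)\<close> times the
  probability of never returning (\<open>green_start_finite\<close>).\<close>

section \<open>Words and paths in the Schreier graph\<close>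

context group begin

lemma foldr_mult_closed: "set ws \<subseteq> carrier G \<Longrightarrow> foldr (\<otimes>) ws \<one> \<in> carrier G"
  by (induction ws) auto

lemma foldr_mult_append:
  assumes "set us \<subseteq> carrier G" "set vs \<subseteq> carrier G"
  shows "foldr (\<otimes>) (us @ vs) \<one> = foldr (\<otimes>) us \<one> \<otimes> foldr (\<otimes>) vs \<one>"
  using assms by (induction us) (auto simp: foldr_mult_closed m_assoc)

lemma letters_closed: "S \<subseteq> carrier G \<Longrightarrow> S \<union> (\<lambda>s. inv s) ` S \<subseteq> carrier G"
  by auto

lemma generate_imp_word:
  assumes "S \<subseteq> carrier G" "g \<in> generate G S"
  shows "\<exists>ws. set ws \<subseteq> S \<union> (\<lambda>s. inv s) ` S \<and> foldr (\<otimes>) ws \<one> = g"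
  using assms(2)
proof induction
  case one
  show ?case by (rule exI[of _ "[]"]) auto
next
  case (incl s)
  then show ?case using assms(1) by (intro exI[of _ "[s]"]) auto
next
  case (inv s)
  then show ?case using assms(1) by (intro exI[of _ "[inv s]"]) auto
next
  case (eng g1 g2)
  then obtain us vs where "set us \<subseteq> S \<union> (\<lambda>s. inv s) ` S" "foldr (\<otimes>) us \<one> = g1"
    "set vs \<subseteq> S \<union> (\<lambda>s. inv s) ` S" "foldr (\<otimes>) vs \<one> = g2" by blast
  with foldr_mult_append[of us vs] letters_closed[OF assms(1)] show ?case
    by (intro exI[of _ "us @ vs"]) (simp, blast)
qed

lemma countable_generate:
  assumes "countable S" "S \<subseteq> carrier G"
  shows "countable (generate G S)"
proof (rule countable_subset)
  show "generate G S \<subseteq> (\<lambda>ws. foldr (\<otimes>) ws \<one>) ` lists (S \<union> (\<lambda>s. inv s) ` S)"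
    using generate_imp_word[OF assms(2)] by (fastforce simp: lists_eq_set)
  show "countable ((\<lambda>ws. foldr (\<otimes>) ws \<one>) ` lists (S \<union> (\<lambda>s. inv s) ` S))"
    using assms(1) by auto
qed

lemma ex_word_of_word_length:
  assumes "S \<subseteq> carrier G" "g \<in> generate G S"
  shows "\<exists>ws. set ws \<subseteq> S \<union> (\<lambda>s. inv s) ` S \<and> length ws = word_length G S g
           \<and> foldr (\<otimes>) ws \<one> = g"
  unfolding word_length_def
  using generate_imp_word[OF assms] by (rule_tac LeastI_ex) blast

end

text \<open>Reading a word from left to right from \<open>x\<close> walks along edges, because the group acts on the
  right; a letter \<open>inv t\<close> traverses an edge labelled \<open>t\<close> backwards.\<close>

lemma (in right_group_action) schreier_path_avoiding:
  assumes "S \<subseteq> carrier G" "x \<in> X" "set ws \<subseteq> S \<union> (\<lambda>s. inv s) ` S"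
    and "\<And>i. i \<le> length ws \<Longrightarrow> act x (foldr (\<otimes>) (take i ws) \<one>) \<notin> K"
  shows "(x, act x (foldr (\<otimes>) ws \<one>)) \<in> (schreier_edges X act S \<inter> (X - K) \<times> (X - K))\<^sup>*"
  using assms(2-)
proof (induction ws arbitrary: x)
  case Nil
  then show ?case by (simp add: act_one)
next
  case (Cons s ws)
  have car: "s \<in> carrier G" "set ws \<subseteq> carrier G"
    using Cons.prems(2) letters_closed[OF assms(1)] by auto
  have step: "act x (foldr (\<otimes>) (s # us) \<one>) = act (act x s) (foldr (\<otimes>) us \<one>)"
    if "set us \<subseteq> carrier G" for us
    using that car Cons.prems(1) by (simp add: act_mult foldr_mult_closed)
  have sx: "act x s \<in> X" using Cons.prems(1) car act_closed by blast
  have "act (act x s) (foldr (\<otimes>) (take i ws) \<one>) \<notin> K" if "i \<le> length ws" for i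
    using Cons.prems(3)[of "Suc i"] that step[of "take i ws"] car(2)
      set_take_subset[of i ws] by auto
  note avoid = this
  have "(act x s, act (act x s) (foldr (\<otimes>) ws \<one>))
      \<in> (schreier_edges X act S \<inter> (X - K) \<times> (X - K))\<^sup>*"
    using Cons.prems(2) avoid by (intro Cons.IH sx) auto
  moreover have "x \<notin> K" using Cons.prems(3)[of 0] Cons.prems(1) by (simp add: act_one)
  moreover have "act x s \<notin> K" using avoid[of 0] sx by (simp add: act_one)
  moreover have "(x, act x s) \<in> schreier_edges X act S"
  proof (cases "s \<in> S")
    case True
    then show ?thesis using Cons.prems(1) by (auto simp: schreier_edges_def)
  next
    case False
    then obtain t where t: "t \<in> S" "s = inv t" using Cons.prems(2) by auto
    then have tc: "t \<in> carrier G" using assms(1) by auto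
    have "act (act x s) t = x"
      using t tc car Cons.prems(1) by (simp add: act_mult[symmetric] act_one)
    then show ?thesis using t sx unfolding schreier_edges_def by force
  qed
  ultimately show ?case using Cons.prems(1) sx step[OF car(2)]
    by (auto intro: converse_rtrancl_into_rtrancl)
qed

section \<open>Convergence to an end\<close>

text \<open>The end is built by hand: \<open>U K\<close> is the component of the trajectory at the first time \<open>T K\<close>
  after which the segments avoid \<open>K\<close>. The set \<open>P n\<close> stands for the vertices of the \<open>n\<close>-th
  segment.\<close>

lemma ex_end_if_segments_escape:
  fixes P :: "nat \<Rightarrow> 'x set"
  assumes X: "\<And>n. x n \<in> X" and start: "\<And>n. x n \<in> P n"
    and seg: "\<And>n K. P n \<inter> K = {} \<Longrightarrow> (x n, x (Suc n)) \<in> (E \<inter> (X - K) \<times> (X - K))\<^sup>*"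
    and escape: "\<And>v. v \<in> X \<Longrightarrow> finite {n. v \<in> P n}"
  shows "\<exists>U \<in> ends X E. converges_to_end X x U"
proof -
  let ?r = "\<lambda>K. (E \<inter> (X - K) \<times> (X - K))\<^sup>*"
  \<comment> \<open>Taking the least such time makes \<open>T\<close> monotone in \<open>K\<close>, so that for \<open>K1 \<subseteq> K2\<close> the base
    point of \<open>U K2\<close> is reached from that of \<open>U K1\<close> by going forward in time.\<close>
  define T where "T K = (LEAST m. \<forall>n\<ge>m. P n \<inter> K = {})" for K
  define U where "U = (\<lambda>K \<in> {K. finite K \<and> K \<subseteq> X}. ?r K `` {x (T K)})"
  have T: "P n \<inter> K = {}" if "finite K" "K \<subseteq> X" "T K \<le> n" for n K
  proof -
    have "finite (\<Union>v\<in>K. {n. v \<in> P n})" using that escape by auto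
    then obtain m where "\<forall>n \<in> (\<Union>v\<in>K. {n. v \<in> P n}). n < m"
      by (meson finite_nat_set_iff_bounded)
    then have "\<forall>n\<ge>m. P n \<inter> K = {}" by fastforce
    then have "\<forall>n\<ge>T K. P n \<inter> K = {}"
      unfolding T_def by (rule LeastI)
    then show ?thesis using that by blast
  qed
  have reach: "(x m, x n) \<in> ?r K" if "finite K" "K \<subseteq> X" "T K \<le> m" "m \<le> n" for m n K
    using \<open>m \<le> n\<close>
  proof (induction n rule: dec_induct)
    case (step n)
    then have "P n \<inter> K = {}" using T that by auto
    from seg[OF this] step.IH show ?case by (rule rtrancl_trans[rotated])
  qed simp
  have "U \<in> (\<Pi>\<^sub>E K \<in> {K. finite K \<and> K \<subseteq> X}. components_off X E K)"
  proof (rule PiE_I)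
    fix K assume K: "K \<in> {K. finite K \<and> K \<subseteq> X}"
    have "x (T K) \<in> X - K" using X start T[of K "T K"] K by blast
    with K show "U K \<in> components_off X E K"
      by (simp add: U_def components_off_def quotientI)
  qed (auto simp: U_def)
  moreover have "U K2 \<subseteq> U K1" if "finite K2" "K2 \<subseteq> X" "K1 \<subseteq> K2" for K1 K2
  proof -
    have K1: "finite K1" "K1 \<subseteq> X" using that by (auto intro: finite_subset)
    have le: "T K1 \<le> T K2" unfolding T_def[of K1]
      using T[OF that(1,2)] that(3) by (intro Least_le) blast
    have "?r K2 \<subseteq> ?r K1" using that(3) by (intro rtrancl_mono) blast
    then show ?thesis using reach[OF K1 order_refl le] that K1
      by (auto simp: U_def intro: rtrancl_trans)
  qed
  moreover have "\<forall>\<^sub>F n in sequentially. x n \<in> U K" if "finite K" "K \<subseteq> X" for K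
    using reach[OF that order_refl] that
    by (auto simp: U_def eventually_sequentially)
  ultimately show ?thesis
    by (intro bexI[of _ U]) (auto simp: ends_def converges_to_end_def)
qed

section \<open>Random walks on a countable group\<close>

text \<open>The increments are required to lie in the countable carrier everywhere, not only almost
  surely. Then every set described by finitely many increments is a countable union of cylinders,
  hence an event; products of group elements need not be measurable for the discrete
  \<open>\<sigma>\<close>-algebra on an uncountable type.\<close>

locale group_random_walk = right_group_action G X act + prob_space M
  for G :: "('g, 'b) monoid_scheme" (structure) and X :: "'x set" and act
    and M :: "'w measure" +
  fixes h :: "nat \<Rightarrow> 'w \<Rightarrow> 'g" and \<mu> :: "'g pmf" and x0 :: 'x
  assumes countable_carrier: "countable (carrier G)"
    and indep: "indep_vars (\<lambda>_. count_space (carrier G)) h UNIV"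
    and law: "g \<in> carrier G \<Longrightarrow> emeasure M {\<omega> \<in> space M. h n \<omega> = g} = pmf \<mu> g"
    and support: "set_pmf \<mu> \<subseteq> carrier G"
    and x0: "x0 \<in> X"
begin

abbreviation "C \<equiv> count_space (carrier G)"
abbreviation "walk \<equiv> induced_walk G act x0 h"

lemma measurable_increment [measurable]: "h n \<in> M \<rightarrow>\<^sub>M C"
  using indep by (auto simp: indep_vars_def)

lemma increment_closed: "\<omega> \<in> space M \<Longrightarrow> h n \<omega> \<in> carrier G"
  using measurable_space[OF measurable_increment] by simp

lemma measurable_group_walk:
  assumes "\<And>i. i < n \<Longrightarrow> k i \<in> N \<rightarrow>\<^sub>M C"
  shows "group_walk G k n \<in> N \<rightarrow>\<^sub>M C"
  using assms
proof (induction n)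
  case 0
  then show ?case by simp
next
  case (Suc n)
  have 1: "group_walk G k n \<in> N \<rightarrow>\<^sub>M C" using Suc by simp
  have 2: "k n \<in> N \<rightarrow>\<^sub>M C" using Suc by simp
  have "(\<lambda>\<omega>. group_walk G k n \<omega> \<otimes> k n \<omega>) \<in> N \<rightarrow>\<^sub>M C"
  proof (rule measurable_compose_countable'[OF _ 1 countable_carrier])
    fix a assume a: "a \<in> carrier G"
    show "(\<lambda>\<omega>. a \<otimes> k n \<omega>) \<in> N \<rightarrow>\<^sub>M C"
      by (rule measurable_compose[OF 2]) (use a in auto)
  qed
  then show ?case by simp
qed

lemma measurable_walk [measurable]: "group_walk G h n \<in> M \<rightarrow>\<^sub>M C"
  by (rule measurable_group_walk) simp

lemma group_walk_closed: "\<omega> \<in> space M \<Longrightarrow> group_walk G h n \<omega> \<in> carrier G"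
  using measurable_space[OF measurable_walk] by simp

lemma walk_closed: "\<omega> \<in> space M \<Longrightarrow> walk n \<omega> \<in> X"
  by (simp add: induced_walk_def act_closed x0 group_walk_closed)

lemma event_measurable [measurable]:
  "{\<omega> \<in> space M. Q (group_walk G h n \<omega>)} \<in> sets M"
proof -
  have "group_walk G h n -` {g \<in> carrier G. Q g} \<inter> space M = {\<omega> \<in> space M. Q (group_walk G h n \<omega>)}"
    using group_walk_closed by auto
  then show ?thesis
    using measurable_sets[OF measurable_walk, of "{g \<in> carrier G. Q g}" n] by simp
qed

lemma walk_event_measurable [measurable]: "{\<omega> \<in> space M. walk n \<omega> = y} \<in> sets M"
  unfolding induced_walk_def by (rule event_measurable)

lemma indep_past_future:
  "indep_var (PiM {..<n} (\<lambda>_. C)) (\<lambda>\<omega>. \<lambda>i\<in>{..<n}. h i \<omega>)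
             (PiM {n..} (\<lambda>_. C)) (\<lambda>\<omega>. \<lambda>i\<in>{n..}. h i \<omega>)"
  by (rule indep_var_restrict[OF indep]) auto

lemma group_walk_cong:
  "(\<And>i. i < n \<Longrightarrow> k i \<omega> = k' i \<omega>') \<Longrightarrow> group_walk G k n \<omega> = group_walk G k' n \<omega>'"
  by (induction n) auto

text \<open>The Markov property in the form of independence: \<open>group_walk G h n\<close> is a function of the
  first \<open>n\<close> increments.\<close>

lemma prob_walk_inter_future:
  assumes B: "B \<in> sets (PiM {n..} (\<lambda>_. C))"
  shows "prob ({\<omega> \<in> space M. Q (group_walk G h n \<omega>)} \<inter> {\<omega> \<in> space M. (\<lambda>i\<in>{n..}. h i \<omega>) \<in> B})
       = prob {\<omega> \<in> space M. Q (group_walk G h n \<omega>)} * prob {\<omega> \<in> space M. (\<lambda>i\<in>{n..}. h i \<omega>) \<in> B}"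
proof -
  let ?past = "PiM {..<n} (\<lambda>_. C)"
  let ?W = "group_walk G (\<lambda>i w. w i) n"
  let ?A = "?W -` {a \<in> carrier G. Q a} \<inter> space ?past"
  have "?W \<in> ?past \<rightarrow>\<^sub>M C"
    by (rule measurable_group_walk) simp
  then have A: "?A \<in> sets ?past" by (rule measurable_sets) auto
  have "?W (\<lambda>i\<in>{..<n}. h i \<omega>) = group_walk G h n \<omega>" for \<omega>
    by (rule group_walk_cong) simp
  then have past: "(\<lambda>\<omega>. \<lambda>i\<in>{..<n}. h i \<omega>) -` ?A \<inter> space M = {\<omega> \<in> space M. Q (group_walk G h n \<omega>)}"
    using group_walk_closed increment_closed by (auto simp: space_PiM)
  have future: "(\<lambda>\<omega>. \<lambda>i\<in>{n..}. h i \<omega>) -` B \<inter> space M = {\<omega> \<in> space M. (\<lambda>i\<in>{n..}. h i \<omega>) \<in> B}"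
    by auto
  have "(\<lambda>\<omega>. (\<lambda>i\<in>{..<n}. h i \<omega>, \<lambda>i\<in>{n..}. h i \<omega>)) -` (?A \<times> B) \<inter> space M
          = {\<omega> \<in> space M. Q (group_walk G h n \<omega>)} \<inter> {\<omega> \<in> space M. (\<lambda>i\<in>{n..}. h i \<omega>) \<in> B}"
    unfolding past[symmetric] future[symmetric] by auto
  then show ?thesis
    using indep_varD[OF indep_past_future A B] unfolding past future by simp
qed

lemma increment_event_measurable:
  assumes "g \<in> carrier G"
  shows "{\<omega> \<in> space M. h n \<omega> = g} \<in> sets M"
  using measurable_sets[OF measurable_increment, of "{g}" n] assms
  by (simp add: vimage_def Int_def conj_commute)

lemma walk_increment_event_measurable:
  "{\<omega> \<in> space M. R (group_walk G h n \<omega>) (h n \<omega>)} \<in> sets M"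
proof -
  have "{\<omega> \<in> space M. R (group_walk G h n \<omega>) (h n \<omega>)}
          = (\<Union>g \<in> carrier G. {\<omega> \<in> space M. R (group_walk G h n \<omega>) g} \<inter> {\<omega> \<in> space M. h n \<omega> = g})"
    using increment_closed by auto
  also have "\<dots> \<in> sets M"
    using countable_carrier increment_event_measurable event_measurable
    by (intro sets.countable_UN' sets.Int) auto
  finally show ?thesis .
qed

text \<open>Conditioning on the value \<open>g\<close> of the increment, which is independent of the past.\<close>

lemma emeasure_walk_increment:
  "emeasure M {\<omega> \<in> space M. R (group_walk G h n \<omega>) (h n \<omega>)}
     = (\<integral>\<^sup>+ g. emeasure M {\<omega> \<in> space M. R (group_walk G h n \<omega>) g} \<partial>\<mu>)"
proof -
  let ?E = "\<lambda>g. {\<omega> \<in> space M. R (group_walk G h n \<omega>) g \<and> h n \<omega> = g}"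
  have E: "?E g \<in> sets M" if "g \<in> carrier G" for g
    using walk_increment_event_measurable[of "\<lambda>a b. R a g \<and> b = g" n] .
  have split: "emeasure M (?E g) = ennreal (pmf \<mu> g) * emeasure M {\<omega> \<in> space M. R (group_walk G h n \<omega>) g}"
    if g: "g \<in> carrier G" for g
  proof -
    let ?B = "{w \<in> space (PiM {n..} (\<lambda>_. C)). w n = g}"
    have "(\<lambda>w. w n) -` {g} \<inter> space (PiM {n..} (\<lambda>_. C)) \<in> sets (PiM {n..} (\<lambda>_. C))"
      using g by (intro measurable_sets[OF measurable_component_singleton]) auto
    also have "(\<lambda>w. w n) -` {g} \<inter> space (PiM {n..} (\<lambda>_. C)) = ?B" by auto
    finally have B: "?B \<in> sets (PiM {n..} (\<lambda>_. C))" .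
    have "{\<omega> \<in> space M. (\<lambda>i\<in>{n..}. h i \<omega>) \<in> ?B} = {\<omega> \<in> space M. h n \<omega> = g}"
      using increment_closed by (auto simp: space_PiM)
    moreover have "{\<omega> \<in> space M. R (group_walk G h n \<omega>) g} \<inter> {\<omega> \<in> space M. h n \<omega> = g} = ?E g" by auto
    ultimately have "prob (?E g) = prob {\<omega> \<in> space M. R (group_walk G h n \<omega>) g} * prob {\<omega> \<in> space M. h n \<omega> = g}"
      using prob_walk_inter_future[OF B, of "\<lambda>a. R a g"] by simp
    then show ?thesis
      using law[OF g] by (simp add: emeasure_eq_measure ennreal_mult' mult.commute)
  qed
  have "{\<omega> \<in> space M. R (group_walk G h n \<omega>) (h n \<omega>)} = (\<Union>g \<in> carrier G. ?E g)"
    using increment_closed by auto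
  also have "emeasure M \<dots> = (\<integral>\<^sup>+ g. emeasure M (?E g) \<partial>count_space (carrier G))"
    using E countable_carrier by (intro emeasure_UN_countable) (auto simp: disjoint_family_on_def)
  also have "\<dots> = (\<integral>\<^sup>+ g. ennreal (pmf \<mu> g) * emeasure M {\<omega> \<in> space M. R (group_walk G h n \<omega>) g}
                    \<partial>count_space (carrier G))"
    by (intro nn_integral_cong) (simp add: split)
  also have "\<dots> = (\<integral>\<^sup>+ g. ennreal (pmf \<mu> g) * emeasure M {\<omega> \<in> space M. R (group_walk G h n \<omega>) g}
                    \<partial>count_space UNIV)"
    using support by (intro nn_integral_count_space_eq) (auto simp: pmf_eq_0_set_pmf)
  also have "\<dots> = (\<integral>\<^sup>+ g. emeasure M {\<omega> \<in> space M. R (group_walk G h n \<omega>) g} \<partial>\<mu>)"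
    by (simp add: nn_integral_measure_pmf)
  finally show ?thesis .
qed

section \<open>The Green function\<close>

text \<open>The \<open>n\<close>-step transition probability from \<open>x0\<close> to \<open>y\<close>; its sum over \<open>n\<close> is the Green
  function of the walk started at \<open>x0\<close>.\<close>

definition hit :: "nat \<Rightarrow> 'x \<Rightarrow> ennreal" where
  "hit n y = emeasure M {\<omega> \<in> space M. walk n \<omega> = y}"

lemma act_eq_iff:
  assumes "x \<in> X" "y \<in> X" "g \<in> carrier G"
  shows "act x g = y \<longleftrightarrow> x = act y (inv g)"
  using assms act_mult[of x g "inv g"] act_mult[of y "inv g" g] by (auto simp: act_one)

lemma hit_Suc:
  assumes "y \<in> X"
  shows "hit (Suc n) y = (\<integral>\<^sup>+ g. hit n (act y (inv g)) \<partial>\<mu>)"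
proof -
  have "walk (Suc n) \<omega> = y \<longleftrightarrow> act x0 (group_walk G h n \<omega>) = act y (inv (h n \<omega>))"
    if \<omega>: "\<omega> \<in> space M" for \<omega>
  proof -
    have "walk (Suc n) \<omega> = act (act x0 (group_walk G h n \<omega>)) (h n \<omega>)"
      using x0 group_walk_closed[OF \<omega>] increment_closed[OF \<omega>]
      by (simp add: induced_walk_def act_mult)
    moreover have "act x0 (group_walk G h n \<omega>) \<in> X"
      using x0 group_walk_closed[OF \<omega>] by (rule act_closed)
    ultimately show ?thesis
      using act_eq_iff assms increment_closed[OF \<omega>] by metis
  qed
  then have "{\<omega> \<in> space M. walk (Suc n) \<omega> = y}
          = {\<omega> \<in> space M. act x0 (group_walk G h n \<omega>) = act y (inv (h n \<omega>))}"
    by blast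
  then show ?thesis
    unfolding hit_def using emeasure_walk_increment[of "\<lambda>a g. act x0 a = act y (inv g)" n]
    by (simp add: induced_walk_def)
qed

lemma hit_0: "hit 0 y = (if y = x0 then 1 else 0)"
  using x0 by (auto simp: hit_def induced_walk_def act_one emeasure_space_1)

text \<open>The maximum principle. The truncated Green function with horizon \<open>N + 1\<close> at \<open>y \<noteq> x0\<close> is, by
  \<open>hit_Suc\<close>, the \<open>\<mu>\<close>-average of the one with horizon \<open>N\<close> over the points
  \<open>act y (inv g)\<close>. Truncation keeps all quantities finite and allows induction on \<open>N\<close>.\<close>

lemma sum_hit_le_sum_hit_start:
  "y \<in> X \<Longrightarrow> (\<Sum>n\<le>N. hit n y) \<le> (\<Sum>n\<le>N. hit n x0)"
proof (induction N arbitrary: y)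
  case 0
  then show ?case by (simp add: hit_0)
next
  case (Suc N)
  show ?case
  proof (cases "y = x0")
    case False
    have "(\<Sum>n\<le>Suc N. hit n y) = (\<Sum>n\<le>N. hit (Suc n) y)"
      using False by (subst sum.atMost_Suc_shift) (simp add: hit_0)
    also have "\<dots> = (\<integral>\<^sup>+ g. (\<Sum>n\<le>N. hit n (act y (inv g))) \<partial>\<mu>)"
      using Suc.prems by (simp add: hit_Suc nn_integral_sum)
    also have "\<dots> \<le> (\<integral>\<^sup>+ g. (\<Sum>n\<le>N. hit n x0) \<partial>\<mu>)"
      using Suc support act_closed
      by (intro nn_integral_mono_AE) (auto simp: AE_measure_pmf_iff)
    also have "\<dots> = (\<Sum>n\<le>N. hit n x0)"
      by (simp add: measure_pmf.emeasure_space_1)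
    also have "\<dots> \<le> (\<Sum>n\<le>Suc N. hit n x0)" by simp
    finally show ?thesis .
  qed simp
qed

lemma green_le_green_start:
  assumes "y \<in> X"
  shows "(\<Sum>n. hit n y) \<le> (\<Sum>n. hit n x0)"
  unfolding suminf_eq_SUP
proof (rule SUP_mono')
  fix N show "(\<Sum>n<N. hit n y) \<le> (\<Sum>n<N. hit n x0)"
    using sum_hit_le_sum_hit_start[OF assms] by (cases N) (auto simp: lessThan_Suc_atMost)
qed

lemma group_walk_add:
  assumes "\<omega> \<in> space M"
  shows "group_walk G h (n + k) \<omega> = group_walk G h n \<omega> \<otimes> group_walk G (\<lambda>i. h (n + i)) k \<omega>"
proof (induction k)
  case 0
  then show ?case using group_walk_closed[OF assms] by simp
next
  case (Suc k)
  have "group_walk G (\<lambda>i. h (n + i)) k \<omega> \<in> carrier G"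
    by (induction k) (use increment_closed[OF assms] in auto)
  with Suc show ?case
    using group_walk_closed[OF assms] increment_closed[OF assms] by (simp add: m_assoc)
qed

text \<open>Both sides are the infinite product of the common law of the increments.\<close>

lemma shifted_increments_law:
  "distr M (PiM UNIV (\<lambda>_. C)) (\<lambda>\<omega> i. h (n + i) \<omega>) = distr M (PiM UNIV (\<lambda>_. C)) (\<lambda>\<omega> i. h i \<omega>)"
proof -
  let ?P = "PiM (UNIV :: nat set) (\<lambda>_. C)"
  define N where "N = distr M C (h 0)"
  have N: "distr M C (h i) = N" for i
    unfolding N_def
  proof (rule measure_eqI_countable[of _ "carrier G"])
    fix g assume g: "g \<in> carrier G"
    have "h j -` {g} \<inter> space M = {\<omega> \<in> space M. h j \<omega> = g}" for j by auto
    then show "emeasure (distr M C (h i)) {g} = emeasure (distr M C (h 0)) {g}"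
      using g law[OF g] by (simp add: emeasure_distr)
  qed (use countable_carrier in auto)
  interpret N: prob_space N unfolding N_def by (rule prob_space_distr) simp
  have H: "distr M ?P (\<lambda>\<omega> i. h i \<omega>) = PiM UNIV (\<lambda>_. N)"
    using indep indep_vars_iff_distr_eq_PiM[where I = UNIV and M' = "\<lambda>_. C" and X = h]
    by (simp add: N restrict_UNIV)
  have sets: "sets (PiM (UNIV :: nat set) (\<lambda>_. N)) = sets ?P"
    by (intro sets_PiM_cong) (auto simp: N_def)
  have mshift: "(\<lambda>w i. w (n + i)) \<in> ?P \<rightarrow>\<^sub>M ?P"
    by (intro measurable_PiM_single') (auto simp: space_PiM PiE_iff)
  have mh: "(\<lambda>\<omega> i. h i \<omega>) \<in> M \<rightarrow>\<^sub>M ?P"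
    by (intro measurable_PiM_single') (auto simp: increment_closed)
  have "distr M ?P (\<lambda>\<omega> i. h (n + i) \<omega>) = distr (distr M ?P (\<lambda>\<omega> i. h i \<omega>)) ?P (\<lambda>w i. w (n + i))"
    using mshift mh by (subst distr_distr) (auto simp: comp_def)
  also have "\<dots> = distr (PiM UNIV (\<lambda>_. N)) (PiM UNIV (\<lambda>_. N)) (\<lambda>w. \<lambda>i\<in>UNIV. w (n + i))"
    unfolding H using sets by (intro distr_cong) auto
  also have "\<dots> = PiM UNIV (\<lambda>_. N)"
    by (rule distr_PiM_reindex[where f = "\<lambda>i. n + i"]) (auto simp: N.prob_space_axioms)
  finally show ?thesis unfolding H .
qed

text \<open>The event is expressed through the increments after time \<open>n\<close> alone: it says that the walk
  restarted at time \<open>n\<close> from \<open>x0\<close> never comes back to \<open>x0\<close>. This makes it independent of the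
  position at time \<open>n\<close>, wherever that is.\<close>

definition no_return :: "nat \<Rightarrow> 'w set" where
  "no_return n = {\<omega> \<in> space M. \<forall>k. act x0 (group_walk G (\<lambda>i. h (n + i)) (Suc k) \<omega>) \<noteq> x0}"

lemma measurable_no_return_pred:
  assumes "\<And>i. n + i \<in> I"
  shows "Measurable.pred (PiM I (\<lambda>_. C))
           (\<lambda>w. \<forall>k. act x0 (group_walk G (\<lambda>i w. w (n + i)) (Suc k) w) \<noteq> x0)"
proof (rule pred_intros_countable)
  fix k
  have "group_walk G (\<lambda>i w. w (n + i)) (Suc k) \<in> PiM I (\<lambda>_. C) \<rightarrow>\<^sub>M C"
    using assms by (intro measurable_group_walk measurable_component_singleton)
  from measurable_compose[OF this, of "\<lambda>a. act x0 a \<noteq> x0" "count_space UNIV"]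
  show "Measurable.pred (PiM I (\<lambda>_. C))
          (\<lambda>w. act x0 (group_walk G (\<lambda>i w. w (n + i)) (Suc k) w) \<noteq> x0)" by simp
qed

lemma emeasure_no_return: "emeasure M (no_return n) = emeasure M (no_return 0)"
proof -
  let ?P = "PiM (UNIV :: nat set) (\<lambda>_. C)"
  let ?A = "{w \<in> space ?P. \<forall>k. act x0 (group_walk G (\<lambda>i w. w i) (Suc k) w) \<noteq> x0}"
  have A: "?A \<in> sets ?P"
    using measurable_no_return_pred[of 0 UNIV] by (simp only: pred_def add_0) simp
  have m: "(\<lambda>\<omega> i. h (n + i) \<omega>) \<in> M \<rightarrow>\<^sub>M ?P" for n
    by (intro measurable_PiM_single') (auto simp: increment_closed)
  have eq: "(\<lambda>\<omega> i. h (n + i) \<omega>) -` ?A \<inter> space M = no_return n" for n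
  proof -
    have "group_walk G (\<lambda>i w. w i) k (\<lambda>i. h (n + i) \<omega>) = group_walk G (\<lambda>i. h (n + i)) k \<omega>" for k \<omega>
      by (rule group_walk_cong) simp
    then show ?thesis
      using increment_closed by (auto simp: no_return_def space_PiM simp del: group_walk.simps)
  qed
  show ?thesis
    using shifted_increments_law[of n] emeasure_distr[OF m A, of n] emeasure_distr[OF m A, of 0]
    unfolding eq by simp
qed

lemma no_return_measurable: "no_return n \<in> sets M"
  and emeasure_last_visit:
    "emeasure M ({\<omega> \<in> space M. walk n \<omega> = x0} \<inter> no_return n) = hit n x0 * emeasure M (no_return 0)"
proof -
  let ?P = "PiM {n..} (\<lambda>_. C)"
  let ?B = "{w \<in> space ?P. \<forall>k. act x0 (group_walk G (\<lambda>i w. w (n + i)) (Suc k) w) \<noteq> x0}"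
  have B: "?B \<in> sets ?P"
    using measurable_no_return_pred[of n "{n..}"] by (simp only: pred_def) simp
  have m: "(\<lambda>\<omega>. \<lambda>i\<in>{n..}. h i \<omega>) \<in> M \<rightarrow>\<^sub>M ?P"
    by (intro measurable_restrict) simp
  have "group_walk G (\<lambda>i w. w (n + i)) k (\<lambda>i\<in>{n..}. h i \<omega>) = group_walk G (\<lambda>i. h (n + i)) k \<omega>" for k \<omega>
    by (rule group_walk_cong) simp
  then have eq: "{\<omega> \<in> space M. (\<lambda>i\<in>{n..}. h i \<omega>) \<in> ?B} = no_return n"
    using increment_closed by (auto simp: no_return_def space_PiM simp del: group_walk.simps)
  show N: "no_return n \<in> sets M"
    using measurable_sets[OF m B] unfolding eq[symmetric] by (simp add: vimage_def Int_def conj_commute)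
  have "prob ({\<omega> \<in> space M. walk n \<omega> = x0} \<inter> no_return n)
          = prob {\<omega> \<in> space M. walk n \<omega> = x0} * prob (no_return n)"
    using prob_walk_inter_future[OF B, of "\<lambda>a. act x0 a = x0"]
    unfolding eq induced_walk_def by simp
  then show "emeasure M ({\<omega> \<in> space M. walk n \<omega> = x0} \<inter> no_return n) = hit n x0 * emeasure M (no_return 0)"
    unfolding hit_def emeasure_no_return[of n, symmetric] by (simp add: emeasure_eq_measure ennreal_mult)
qed

text \<open>The event \<open>L n\<close> that the last visit to \<open>x0\<close> happens at time \<open>n\<close> has probability
  \<open>hit n x0\<close> times the escape probability \<open>q\<close>. These disjoint events cover almost every
  trajectory, so the Green function at \<open>x0\<close> times \<open>q\<close> equals \<open>1\<close>. In particular \<open>q\<close> is not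
  zero.\<close>

lemma green_start_finite:
  assumes "AE \<omega> in M. finite {n. walk n \<omega> = x0}"
  shows "(\<Sum>n. hit n x0) < \<infinity>"
proof -
  let ?q = "emeasure M (no_return 0)"
  define L where "L n = {\<omega> \<in> space M. walk n \<omega> = x0} \<inter> no_return n" for n
  have L: "L n \<in> sets M" for n
    unfolding L_def using no_return_measurable by auto
  have L_eq: "L n = {\<omega> \<in> space M. walk n \<omega> = x0 \<and> (\<forall>m>n. walk m \<omega> \<noteq> x0)}" for n
  proof -
    have walk_add: "walk (n + Suc k) \<omega> = act (walk n \<omega>) (group_walk G (\<lambda>i. h (n + i)) (Suc k) \<omega>)"
      if "\<omega> \<in> space M" for k \<omega>
    proof -
      have "group_walk G (\<lambda>i. h (n + i)) k \<omega> \<in> carrier G" for k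
        by (induction k) (use increment_closed[OF that] in auto)
      then show ?thesis
        unfolding induced_walk_def group_walk_add[OF that]
        by (intro act_mult x0 group_walk_closed that)
    qed
    have later: "(\<forall>m>n. walk m \<omega> \<noteq> x0) \<longleftrightarrow> (\<forall>k. walk (n + Suc k) \<omega> \<noteq> x0)" for \<omega>
      by (metis add_Suc_right less_add_Suc1 less_imp_Suc_add)
    show ?thesis
      unfolding L_def no_return_def later Collect_conj_eq[symmetric]
      by (intro Collect_cong) (metis walk_add)
  qed
  have "disjoint_family L"
    unfolding disjoint_family_on_def L_eq by (blast elim: linorder_neqE_nat)
  then have "(\<Sum>n. emeasure M (L n)) = emeasure M (\<Union>n. L n)"
    using L by (intro suminf_emeasure) auto
  then have sum: "(\<Sum>n. hit n x0) * ?q = emeasure M (\<Union>n. L n)"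
    unfolding L_def by (simp add: emeasure_last_visit)
  \<comment> \<open>A trajectory with finitely many visits has a last one, since it visits \<open>x0\<close> at time \<open>0\<close>.\<close>
  have "AE \<omega> in M. \<omega> \<in> (\<Union>n. L n)"
    using assms AE_space
  proof eventually_elim
    case (elim \<omega>)
    let ?V = "{n. walk n \<omega> = x0}"
    have "0 \<in> ?V" using x0 by (simp add: induced_walk_def act_one)
    with elim(1) have "Max ?V \<in> ?V" by (intro Max_in) auto
    moreover have "\<forall>m > Max ?V. m \<notin> ?V" using elim(1) Max_ge leD by blast
    ultimately show ?case using elim(2) unfolding L_eq by blast
  qed
  then have "emeasure M (\<Union>n. L n) = 1"
    using L by (intro emeasure_eq_1_AE) auto
  with sum have *: "(\<Sum>n. hit n x0) * ?q = 1" by simp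
  then have "?q \<noteq> 0" by auto
  with * show ?thesis
    by (cases "(\<Sum>n. hit n x0) = \<infinity>") (auto simp: ennreal_top_mult less_top)
qed

section \<open>Finitely many passages through a vertex\<close>

text \<open>Here \<open>c g i\<close> is the \<open>i\<close>-th intermediate point of a path of length \<open>l g\<close> attached to \<open>g\<close>.
  The bound on the Green function turns the expected number of passages through \<open>v\<close> into at most
  \<open>(l g + 1)\<close> times a constant, averaged over \<open>g\<close>; Borel-Cantelli concludes.\<close>

lemma AE_finite_passages_through:
  fixes l :: "'g \<Rightarrow> nat" and c :: "'g \<Rightarrow> nat \<Rightarrow> 'g"
  assumes green: "(\<Sum>n. hit n x0) < \<infinity>"
    and moment: "(\<integral>\<^sup>+ g. of_nat (l g) \<partial>\<mu>) < \<infinity>"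
    and c: "\<And>g i. g \<in> carrier G \<Longrightarrow> c g i \<in> carrier G"
    and v: "v \<in> X"
  shows "AE \<omega> in M. finite {n. \<exists>i\<le>l (h n \<omega>). act (walk n \<omega>) (c (h n \<omega>) i) = v}"
proof -
  let ?Gr = "\<Sum>n. hit n x0"
  let ?R = "\<lambda>a g. \<exists>i\<le>l g. act (act x0 a) (c g i) = v"
  define E where "E n = {\<omega> \<in> space M. ?R (group_walk G h n \<omega>) (h n \<omega>)}" for n
  have E: "E n \<in> sets M" for n
    unfolding E_def by (rule walk_increment_event_measurable)
  have "emeasure M (E n) \<le> (\<integral>\<^sup>+ g. (\<Sum>i\<le>l g. hit n (act v (inv (c g i)))) \<partial>\<mu>)" for n
    unfolding E_def emeasure_walk_increment[of ?R n]
  proof (rule nn_integral_mono_AE, rule AE_pmfI)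
    fix g assume "g \<in> set_pmf \<mu>"
    then have g: "g \<in> carrier G" using support by auto
    have "act (walk n \<omega>) (c g i) = v \<longleftrightarrow> walk n \<omega> = act v (inv (c g i))"
      if "\<omega> \<in> space M" for \<omega> i
      using act_eq_iff[OF walk_closed[OF that] v c[OF g]] .
    then have "{\<omega> \<in> space M. ?R (group_walk G h n \<omega>) g}
            = (\<Union>i\<le>l g. {\<omega> \<in> space M. walk n \<omega> = act v (inv (c g i))})"
      unfolding induced_walk_def by blast
    also have "emeasure M \<dots> \<le> (\<Sum>i\<le>l g. emeasure M {\<omega> \<in> space M. walk n \<omega> = act v (inv (c g i))})"
      by (rule emeasure_subadditive_finite) auto
    finally show "emeasure M {\<omega> \<in> space M. ?R (group_walk G h n \<omega>) g}
      \<le> (\<Sum>i\<le>l g. hit n (act v (inv (c g i))))" by (simp add: hit_def)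
  qed
  then have "(\<Sum>n. emeasure M (E n)) \<le> (\<Sum>n. \<integral>\<^sup>+ g. (\<Sum>i\<le>l g. hit n (act v (inv (c g i)))) \<partial>\<mu>)"
    by (intro suminf_le) auto
  also have "\<dots> = (\<integral>\<^sup>+ g. (\<Sum>n. \<Sum>i\<le>l g. hit n (act v (inv (c g i)))) \<partial>\<mu>)"
    by (intro nn_integral_suminf[symmetric]) simp
  also have "\<dots> = (\<integral>\<^sup>+ g. (\<Sum>i\<le>l g. \<Sum>n. hit n (act v (inv (c g i)))) \<partial>\<mu>)"
    by (simp add: suminf_sum)
  also have "\<dots> \<le> (\<integral>\<^sup>+ g. (of_nat (l g) + 1) * ?Gr \<partial>\<mu>)"
  proof (rule nn_integral_mono_AE, rule AE_pmfI)
    fix g assume "g \<in> set_pmf \<mu>"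
    then have g: "g \<in> carrier G" using support by auto
    have "(\<Sum>i\<le>l g. \<Sum>n. hit n (act v (inv (c g i)))) \<le> (\<Sum>i\<le>l g. ?Gr)"
      using c[OF g] v act_closed by (intro sum_mono green_le_green_start) auto
    then show "(\<Sum>i\<le>l g. \<Sum>n. hit n (act v (inv (c g i)))) \<le> (of_nat (l g) + 1) * ?Gr"
      by (simp add: add.commute)
  qed
  also have "\<dots> = ((\<integral>\<^sup>+ g. of_nat (l g) \<partial>\<mu>) + 1) * ?Gr"
    by (simp add: nn_integral_multc nn_integral_add measure_pmf.emeasure_space_1)
  also have "\<dots> < \<infinity>"
    using green moment by (simp add: ennreal_mult_less_top)
  finally have fin: "(\<Sum>n. emeasure M (E n)) < \<infinity>" .
  have "AE \<omega> in M. finite {n. \<omega> \<in> E n}"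
  proof -
    have "summable (\<lambda>n. measure M (E n))"
      using fin by (intro summable_suminf_not_top) (auto simp: emeasure_eq_measure)
    from borel_cantelli_AE1[OF E _ this] show ?thesis
      by (simp add: less_top[symmetric] cofinite_eq_sequentially[symmetric] eventually_cofinite)
  qed
  then show ?thesis
    using AE_space by eventually_elim (simp add: E_def induced_walk_def)
qed

end

section \<open>Almost sure convergence\<close>

lemma (in group_random_walk) AE_converges_to_end:
  assumes S: "S \<subseteq> carrier G" "generate G S = carrier G"
    and moment: "(\<integral>\<^sup>+ g. of_nat (word_length G S g) \<partial>\<mu>) < \<infinity>"
    and visits: "AE \<omega> in M. finite {n. walk n \<omega> = x0}"
    and X: "countable X"
  shows "AE \<omega> in M. \<exists>U \<in> ends X (schreier_edges X act S). converges_to_end X (\<lambda>n. walk n \<omega>) U"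
proof -
  have "\<forall>g\<in>carrier G. \<exists>ws. set ws \<subseteq> S \<union> (\<lambda>s. inv s) ` S
      \<and> length ws = word_length G S g \<and> foldr (\<otimes>) ws \<one> = g"
    using ex_word_of_word_length[OF S(1)] S(2) by auto
  from bchoice[OF this] obtain word where
      word: "g \<in> carrier G \<Longrightarrow> set (word g) \<subseteq> S \<union> (\<lambda>s. inv s) ` S"
        "g \<in> carrier G \<Longrightarrow> length (word g) = word_length G S g"
        "g \<in> carrier G \<Longrightarrow> foldr (\<otimes>) (word g) \<one> = g" for g
    by blast
  define c where "c g i = foldr (\<otimes>) (take i (word g)) \<one>" for g i
  have c: "c g i \<in> carrier G" if "g \<in> carrier G" for g i
    unfolding c_def using word(1)[OF that] letters_closed[OF S(1)] set_take_subset[of i "word g"]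
    by (intro foldr_mult_closed) blast
  define P where "P \<omega> n = (\<lambda>i. act (walk n \<omega>) (c (h n \<omega>) i)) ` {..word_length G S (h n \<omega>)}" for \<omega> n
  have "AE \<omega> in M. \<forall>v\<in>X. finite {n. v \<in> P \<omega> n}"
  proof (rule AE_ball_countable'[OF _ X])
    fix v assume "v \<in> X"
    have "v \<in> P \<omega> n \<longleftrightarrow> (\<exists>i\<le>word_length G S (h n \<omega>). act (walk n \<omega>) (c (h n \<omega>) i) = v)" for \<omega> n
      by (auto simp: P_def)
    then show "AE \<omega> in M. finite {n. v \<in> P \<omega> n}"
      using AE_finite_passages_through[OF green_start_finite[OF visits] moment, of c] c \<open>v \<in> X\<close>
      by simp
  qed
  then show ?thesis
    using AE_space
  proof eventually_elim
    case (elim \<omega>)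
    note h = increment_closed[OF elim(2)] and w = walk_closed[OF elim(2)]
    show ?case
    proof (rule ex_end_if_segments_escape[where P = "P \<omega>"])
      show "walk n \<omega> \<in> P \<omega> n" for n
      proof -
        have "walk n \<omega> = act (walk n \<omega>) (c (h n \<omega>) 0)" by (simp add: c_def act_one w)
        then show ?thesis unfolding P_def by blast
      qed
      show "(walk n \<omega>, walk (Suc n) \<omega>) \<in> (schreier_edges X act S \<inter> (X - K) \<times> (X - K))\<^sup>*"
        if "P \<omega> n \<inter> K = {}" for n K
      proof -
        have "walk (Suc n) \<omega> = act (walk n \<omega>) (foldr (\<otimes>) (word (h n \<omega>)) \<one>)"
          using act_mult[OF x0 group_walk_closed[OF elim(2)] h]
          by (simp add: induced_walk_def word(3)[OF h])
        moreover have "act (walk n \<omega>) (c (h n \<omega>) i) \<notin> K" if "i \<le> length (word (h n \<omega>))" for i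
          using \<open>P \<omega> n \<inter> K = {}\<close> that unfolding P_def word(2)[OF h] by blast
        ultimately show ?thesis
          using schreier_path_avoiding[OF S(1) w word(1)[OF h], of n n K] by (simp add: c_def)
      qed
    qed (use w elim(1) in auto)
  qed
qed

lemma finite_first_moment_imp_nn_integral:
  assumes "finite_first_moment G S \<mu>" "set_pmf \<mu> \<subseteq> carrier G"
  shows "(\<integral>\<^sup>+ g. of_nat (word_length G S g) \<partial>measure_pmf \<mu>) < \<infinity>"
proof -
  let ?f = "\<lambda>g. real (word_length G S g) * pmf \<mu> g"
  have "Infinite_Set_Sum.abs_summable_on ?f (carrier G)"
    using assms(1) summable_on_iff_abs_summable_on_real[of ?f] abs_summable_equivalent[of ?f]
    unfolding finite_first_moment_def by blast
  then have "integrable (count_space (carrier G)) ?f"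
    unfolding Infinite_Set_Sum.abs_summable_on_def .
  then have "(\<integral>\<^sup>+ g. ennreal (norm (?f g)) \<partial>count_space (carrier G)) < \<infinity>"
    by (simp add: integrable_iff_bounded)
  also have "(\<integral>\<^sup>+ g. ennreal (norm (?f g)) \<partial>count_space (carrier G))
        = (\<integral>\<^sup>+ g. ennreal (pmf \<mu> g) * of_nat (word_length G S g) \<partial>count_space (carrier G))"
    by (intro nn_integral_cong)
      (simp add: abs_mult ennreal_mult mult.commute ennreal_of_nat_eq_real_of_nat)
  also have "\<dots> = (\<integral>\<^sup>+ g. ennreal (pmf \<mu> g) * of_nat (word_length G S g) \<partial>count_space UNIV)"
    using assms(2) by (intro nn_integral_count_space_eq) (auto simp: pmf_eq_0_set_pmf)
  finally show ?thesis by (simp add: nn_integral_measure_pmf)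
qed

theorem theorem1p1:
  fixes G :: "('g, 'b) monoid_scheme"
    and X :: "'x set"
    and act :: "'x \<Rightarrow> 'g \<Rightarrow> 'x"
    and S :: "'g set"
    and \<mu> :: "'g pmf"
    and M :: "'w measure"
    and h :: "nat \<Rightarrow> 'w \<Rightarrow> 'g"
    and x0 :: 'x
  assumes "transitive_right_action G X act"
    and "finite S" and "S \<subseteq> carrier G" and "generate G S = carrier G"
    and "set_pmf \<mu> \<subseteq> carrier G"
    and "finite_first_moment G S \<mu>"
    and "prob_space M" and "iid_with_law M h \<mu>"
    and "x0 \<in> X"
    and "transient_walk M X (induced_walk G act x0 h)"
  shows "AE \<omega> in M. \<exists>U \<in> ends X (schreier_edges X act S).
           converges_to_end X (\<lambda>n. induced_walk G act x0 h n \<omega>) U"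
proof -
  interpret transitive_right_action G X act by fact
  interpret prob_space M by fact
  have countable_G: "countable (carrier G)"
    using countable_generate[of S] assms(2-4) by (simp add: countable_finite)
  have countable_X: "countable X"
  proof (rule countable_subset)
    show "X \<subseteq> act x0 ` carrier G" using transitive[OF assms(9)] by blast
  qed (use countable_G in simp)
  \<comment> \<open>The increments are changed on a null set to make them take values in the countable group
    everywhere.\<close>
  define k where "k n \<omega> = (if h n \<omega> \<in> carrier G then h n \<omega> else \<one>\<^bsub>G\<^esub>)" for n \<omega>
  have indep_h: "indep_vars (\<lambda>_. count_space UNIV) h UNIV"
    and law_h: "distr M (count_space UNIV) (h n) = measure_pmf \<mu>" for n
    using assms(8) by (auto simp: iid_with_law_def)
  have mh: "h n \<in> M \<rightarrow>\<^sub>M count_space UNIV" for n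
    using indep_h by (simp add: indep_vars_def)
  have "AE g in distr M (count_space UNIV) (h n). g \<in> carrier G" for n
    unfolding law_h AE_measure_pmf_iff using assms(5) by auto
  then have "AE \<omega> in M. h n \<omega> \<in> carrier G" for n
    by (rule AE_distrD[OF mh])
  then have "AE \<omega> in M. \<forall>n. h n \<omega> \<in> carrier G"
    by (simp add: AE_all_countable)
  then have AE_k: "AE \<omega> in M. \<forall>n. h n \<omega> = k n \<omega>"
    by eventually_elim (simp add: k_def)
  interpret k: group_random_walk G X act M k \<mu> x0
  proof
    show "indep_vars (\<lambda>_. count_space (carrier G)) k UNIV"
      unfolding k_def by (rule indep_vars_compose2[OF indep_h]) auto
    show "emeasure M {\<omega> \<in> space M. k n \<omega> = g} = ennreal (pmf \<mu> g)" if "g \<in> carrier G" for n g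
    proof -
      have "emeasure M {\<omega> \<in> space M. k n \<omega> = g} = emeasure M (h n -` {g} \<inter> space M)"
      proof (rule emeasure_eq_AE)
        show "AE \<omega> in M. \<omega> \<in> {\<omega> \<in> space M. k n \<omega> = g} \<longleftrightarrow> \<omega> \<in> h n -` {g} \<inter> space M"
          using AE_k by eventually_elim auto
        have "{\<omega> \<in> space M. k n \<omega> = g}
            = h n -` {a. (if a \<in> carrier G then a else \<one>\<^bsub>G\<^esub>) = g} \<inter> space M"
          by (auto simp: k_def)
        then show "{\<omega> \<in> space M. k n \<omega> = g} \<in> sets M"
          by (simp only:) (rule measurable_sets[OF mh], simp)
      qed (use measurable_sets[OF mh] in simp)
      also have "\<dots> = emeasure (measure_pmf \<mu>) {g}"
        unfolding law_h[of n, symmetric] using mh by (simp add: emeasure_distr)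
      finally show ?thesis by (simp add: emeasure_pmf_single)
    qed
  qed (use countable_G assms in auto)
  have walk_k: "AE \<omega> in M. \<forall>n. induced_walk G act x0 h n \<omega> = induced_walk G act x0 k n \<omega>"
    using AE_k
  proof eventually_elim
    case (elim \<omega>)
    then show ?case
      using k.group_walk_cong[of _ h \<omega> k \<omega>] by (simp add: induced_walk_def)
  qed
  have "AE \<omega> in M. finite {n. induced_walk G act x0 h n \<omega> = x0}"
    using assms(9,10) by (simp add: transient_walk_def)
  then have "AE \<omega> in M. finite {n. induced_walk G act x0 k n \<omega> = x0}"
    using walk_k by eventually_elim simp
  from k.AE_converges_to_end[OF assms(3,4) finite_first_moment_imp_nn_integral[OF assms(6,5)] this countable_X]
  show ?thesis
    using walk_k by eventually_elim simp
qed

end
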